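(* Let $C$ be a closed convex cone in $H$, $K$ a nonempty closed convex subset of $C$ with $K^\infty$ pointed, and let $f:C\to H$ and $g:H\to H$ be weakly homogeneous mappings of degrees $\delta_1>0$ and $\delta_2>0$, respectively, written $f=f^\infty+\bar f+p$ and $g=g^\infty+\bar g+q$. Let $F,F^\infty:H\to H$ be any given continuous extensions of $f^\infty+\bar f-\bar f(0)$ and $f^\infty$, respectively. Suppose that $g^{-1}(C)\subseteq C$, that $\bar g(x)+q\in C$ as $\|x\|\to\infty$ (i.e. for all $x\in H$ with $\|x\|$ sufficiently large), and that there exists a vector $d\in\mathrm{int}((K^\infty)^* )$ such that one of the following conditions holds: (a) SOL$(f^\infty,g^\infty,K^\infty)=\{0\}=$ SOL$(f^\infty+\bar f-\bar f(0)+d,\,g,\,K^\infty)$, and $g$ is an injective mapping for which there exists an $x^*\in H$ such that $g(x^* )=0$ and $\mathrm{dist}(F(x),g(x))<\mathrm{dist}(d,\partial((K^\infty)^* ))$ as $x\to x^*$ (i.e. for all $x$ in some neighborhood of $x^*$); (b) SOL$(f^\infty,g^\infty,K^\infty)=\{0\}=$ SOL$(f^\infty+d,\,g^\infty,\,K^\infty)$, and $g^\infty$ is an injective mapping. Then WHGVI$(f,g,K)$ and WHGCP$(f,g,K^\infty)$ have nonempty compact solution sets. Furthermore, if additionally $f$ is strictly monotone with respect to $g$ on $K$, then WHGVI$(f,g,K)$ has a unique solution; and if additionally $f$ is strictly monotone with respect to $g$ on $K^\infty$, then WHGCP$(f,g,K^\infty)$ has a unique solution.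
   Context: $H$ is a finite dimensional real Hilbert space with inner product $\langle\cdot,\cdot\rangle$ and norm $\|\cdot\|$; $\mathrm{dist}(u,v)=\|u-v\|$ for points and $\mathrm{dist}(d,S)=\inf_{s\in S}\|d-s\|$ for a set $S$ (equal to $+\infty$ if $S=\emptyset$); $\mathrm{int}$ and $\partial$ denote interior and boundary; $g^{-1}(C)=\{x\in H\mid g(x)\in C\}$; the dual cone of $S$ is $S^*=\{u\in H\mid \langle u,x\rangle\ge0\ \forall x\in S\}$; the recession cone of $K$ is $K^\infty:=\{u\in H\mid \exists t_k\to\infty,\ \exists x^k\in K \text{ such that } x^k/t_k\to u\}$. Weakly homogeneous mappings: let $D\subseteq H$ be a closed convex cone ($D=C$ for $f$, $D=H$ for $g$). A continuous $h:D\to H$ is positively homogeneous of degree $\delta$ if $h(\lambda x)=\lambda^\delta h(x)$ for all $x\in D$, $\lambda>0$. A mapping $\varphi:D\to H$ is weakly homogeneous of degree $\delta>0$ if $\varphi=h+e$ with $h$ positively homogeneous of degree $\delta$ and $e:D\to H$ continuous with $e(x)/\|x\|^\delta\to0$ as $\|x\|\to\infty$ in $D$; $h$ is unique, is called the leading term and is denoted $\varphi^\infty$. In $f=f^\infty+\bar f+p$, $p\in H$ is the constant item and $\bar f:=f-f^\infty-p$; likewise $q\in H$ and $\bar g:=g-g^\infty-q$. Thus $\bar g+q=g-g^\infty$ and $f^\infty+\bar f-\bar f(0)=f-f(0)$. For mappings $\phi$ (on $C$ or $H$), $\psi:H\to H$ and closed convex $S$, SOL$(\phi,\psi,S)$ is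 the set of $x$ such that $\psi(x)\in S$ and $\langle\phi(x),y-\psi(x)\rangle\ge0$ for all $y\in S$; if $S$ is a cone this is equivalent to $\psi(x)\in S$, $\phi(x)\in S^*$, $\langle\phi(x),\psi(x)\rangle=0$. WHGVI$(f,g,K)$ is the problem with solution set SOL$(f,g,K)$, and WHGCP$(f,g,K^\infty)$ is the problem of finding $x\in H$ with $g(x)\in K^\infty$, $f(x)\in(K^\infty)^*$, $\langle f(x),g(x)\rangle=0$. $f$ is strictly monotone with respect to $g$ on $S$ if $g(x),g(y)\in S$ and $x\ne y$ imply $\langle f(x)-f(y),g(x)-g(y)\rangle>0$. *)

theory Defs
  imports "HOL-Analysis.Analysis"
begin

text \<open>
  A mapping with domain \<open>D\<close> is a total function together with the set \<open>D\<close>; its values outside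
  \<open>D\<close> are irrelevant, so the notions below take the domain as an explicit argument.
\<close>

definition dual_cone :: "'a::real_inner set \<Rightarrow> 'a set" where
  "dual_cone S = {u. \<forall>x\<in>S. 0 \<le> u \<bullet> x}"

definition recession_cone :: "'a::real_normed_vector set \<Rightarrow> 'a set" where
  "recession_cone K =
     {u. \<exists>(t :: nat \<Rightarrow> real) (x :: nat \<Rightarrow> 'a). filterlim t at_top sequentially \<and> (\<forall>k. x k \<in> K) \<and>
           (\<lambda>k. x k /\<^sub>R t k) \<longlonglongrightarrow> u}"

definition pointed_cone :: "'a::real_vector set \<Rightarrow> bool" where
  "pointed_cone S \<longleftrightarrow> S \<inter> uminus ` S = {0}"

text \<open>
  Unlike \<^const>\<open>infdist\<close>, which is \<open>0\<close> for the empty set, this distance is \<open>\<infinity>\<close> there.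
\<close>

definition point_set_dist :: "'a::metric_space \<Rightarrow> 'a set \<Rightarrow> ereal" where
  "point_set_dist d S = (INF s\<in>S. ereal (dist d s))"

definition positively_homogeneous_on ::
    "'a::real_normed_vector set \<Rightarrow> real \<Rightarrow> ('a \<Rightarrow> 'a) \<Rightarrow> bool" where
  "positively_homogeneous_on D \<delta> h \<longleftrightarrow>
     continuous_on D h \<and> (\<forall>x\<in>D. \<forall>l>0. h (l *\<^sub>R x) = (l powr \<delta>) *\<^sub>R h x)"

text \<open>
  For \<open>\<delta> > 0\<close> and \<open>D\<close> a cone, the leading term \<open>h\<close> of \<open>\<phi>\<close> is uniquely determined on \<open>D\<close>.
\<close>

definition leading_term_on ::
    "'a::real_normed_vector set \<Rightarrow> real \<Rightarrow> ('a \<Rightarrow> 'a) \<Rightarrow> ('a \<Rightarrow> 'a) \<Rightarrow> bool" where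
  "leading_term_on D \<delta> \<phi> h \<longleftrightarrow>
     positively_homogeneous_on D \<delta> h \<and>
     (\<exists>e. continuous_on D e \<and> (\<forall>x\<in>D. \<phi> x = h x + e x) \<and>
          ((\<lambda>x. e x /\<^sub>R (norm x powr \<delta>)) \<longlongrightarrow> 0) (inf at_infinity (principal D)))"

definition weakly_homogeneous_on ::
    "'a::real_normed_vector set \<Rightarrow> real \<Rightarrow> ('a \<Rightarrow> 'a) \<Rightarrow> bool" where
  "weakly_homogeneous_on D \<delta> \<phi> \<longleftrightarrow> \<delta> > 0 \<and> (\<exists>h. leading_term_on D \<delta> \<phi> h)"

definition GVI_SOL ::
    "'a::real_inner set \<Rightarrow> ('a \<Rightarrow> 'a) \<Rightarrow> ('a \<Rightarrow> 'a) \<Rightarrow> 'a set \<Rightarrow> 'a set" where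
  "GVI_SOL D \<phi> \<psi> S = {x\<in>D. \<psi> x \<in> S \<and> (\<forall>y\<in>S. 0 \<le> \<phi> x \<bullet> (y - \<psi> x))}"

definition GCP_SOL ::
    "'a::real_inner set \<Rightarrow> ('a \<Rightarrow> 'a) \<Rightarrow> ('a \<Rightarrow> 'a) \<Rightarrow> 'a set \<Rightarrow> 'a set" where
  "GCP_SOL D \<phi> \<psi> S = {x\<in>D. \<psi> x \<in> S \<and> \<phi> x \<in> dual_cone S \<and> \<phi> x \<bullet> \<psi> x = 0}"

definition strictly_monotone_wrt ::
    "'a::real_inner set \<Rightarrow> ('a \<Rightarrow> 'a) \<Rightarrow> ('a \<Rightarrow> 'a) \<Rightarrow> 'a set \<Rightarrow> bool" where
  "strictly_monotone_wrt D f g S \<longleftrightarrow>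
     (\<forall>x\<in>D. \<forall>y\<in>D. g x \<in> S \<longrightarrow> g y \<in> S \<longrightarrow> x \<noteq> y \<longrightarrow> 0 < (f x - f y) \<bullet> (g x - g y))"

end

theory Submission
  imports Defs
begin

text \<open>
  A point solves the variational inequality of \<open>\<phi>\<close>, \<open>\<psi>\<close> over \<open>S\<close> iff it is a zero of the natural map
  \<open>\<psi> - \<Pi>\<^sub>S(\<psi> - \<phi>)\<close>. Composing \<open>f\<close> with \<open>\<Pi>\<^sub>C\<close> extends it to a weakly homogeneous mapping on the whole space
  without changing the solutions. Rescaling \<open>\<psi>(R x)\<close>, \<open>\<phi>(R x)\<close> and \<open>S\<close> by powers of \<open>R\<close> given by the two
  degrees turns the natural map on the sphere of radius \<open>R\<close> into a map on the unit sphere that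
  converges uniformly, as \<open>R \<rightarrow> \<infinity>\<close>, to the natural map of the leading terms over the recession cone. The latter
  has no zero there, so solution sets are bounded, and all problems with the same leading terms
  and recession cone give maps of the unit sphere into \<open>H \<setminus> {0}\<close> in one homotopy class. If the problem
  had no solution this class would be trivial. For the reference problem with the vector \<open>d\<close>, however, the
  only zero is \<open>0\<close>, near which the projection vanishes (as \<open>d\<close> is interior to the dual cone) and the
  natural map is the injective mapping \<open>g\<close> or \<open>g\<^sup>\<infinity>\<close>. Invariance of domain and the no-retraction
  theorem show that the class is nontrivial.
\<close>

section \<open>Injective maps and nullhomotopy\<close>

text \<open>A zero-free \<open>h\<close> could be transported by the inverse of \<open>G\<close> to
  the image of the ball and glued to the identity outside. Normalising the glued map would retract a
  large ball onto its boundary sphere.\<close>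

lemma injective_no_zero_free_extension:
  fixes G h :: "'a::euclidean_space \<Rightarrow> 'a"
  assumes contG: "continuous_on (cball 0 r) G" and inj: "inj_on G (cball 0 r)"
    and r: "0 < r" and G0: "G 0 = 0"
    and conth: "continuous_on (cball 0 r) h" and nz: "\<And>x. x \<in> cball 0 r \<Longrightarrow> h x \<noteq> 0"
    and eq: "\<And>x. x \<in> sphere 0 r \<Longrightarrow> h x = G x"
  shows False
proof -
  have opn: "open (G ` ball 0 r)"
    using invariance_of_domain_ball[OF contG r inj] .
  have cpt: "compact (G ` cball 0 r)"
    by (intro compact_continuous_image contG compact_cball)
  then obtain B where B: "B > 0" "G ` cball 0 r \<subseteq> ball 0 B"
    using bounded_subset_ballD[OF compact_imp_bounded] by metis
  define Gi where "Gi = inv_into (cball 0 r) G"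
  have Gi: "Gi (G x) = x" if "x \<in> cball 0 r" for x
    using that inj by (simp add: Gi_def)
  have contGi: "continuous_on (G ` cball 0 r) Gi"
    by (rule continuous_on_inv[OF contG]) (use Gi in auto)
  have overlap: "h (Gi y) = y" if y: "y \<in> G ` cball 0 r" "y \<notin> G ` ball 0 r" for y
  proof -
    obtain x where x: "x \<in> cball 0 r" "y = G x" using y(1) by blast
    then have "x \<in> sphere 0 r" using y(2) by (auto simp: image_iff)
    then show ?thesis using eq x Gi by simp
  qed
  \<comment> \<open>On the image of the ball \<open>k\<close> replaces the identity by the zero-free \<open>h \<circ> G\<inverse>\<close>;
    both agree on the image of the sphere.\<close>
  define k where "k = (\<lambda>y. if y \<in> G ` cball 0 r then h (Gi y) else y)"
  have "continuous_on (G ` cball 0 r \<union> (cball 0 B - G ` ball 0 r)) k"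
    unfolding k_def
  proof (rule continuous_on_cases)
    show "closed (G ` cball 0 r)" using cpt by (rule compact_imp_closed)
    show "closed (cball 0 B - G ` ball 0 r)" using opn by (simp add: closed_Diff)
    show "continuous_on (G ` cball 0 r) (\<lambda>y. h (Gi y))"
      by (rule continuous_on_compose2[OF conth contGi]) (use Gi in auto)
    show "\<forall>y. y \<in> G ` cball 0 r \<and> y \<notin> G ` cball 0 r
          \<or> y \<in> cball 0 B - G ` ball 0 r \<and> y \<in> G ` cball 0 r \<longrightarrow> h (Gi y) = y"
      using overlap by blast
  qed (rule continuous_on_id)
  moreover have "G ` cball 0 r \<union> (cball 0 B - G ` ball 0 r) = cball 0 B"
    using B(2) ball_subset_cball by blast
  ultimately have contk: "continuous_on (cball 0 B) k" by simp
  have k_nz: "k y \<noteq> 0" if "y \<in> cball 0 B" for y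
  proof (cases "y \<in> G ` cball 0 r")
    case True
    then show ?thesis using nz Gi by (auto simp: k_def)
  next
    case False
    \<comment> \<open>The identity piece could vanish only at 0, but 0 is \<open>G 0\<close> and so
      belongs to the other piece.\<close>
    have "0 \<in> G ` cball 0 r" using r G0 by (intro image_eqI[of _ _ 0]) auto
    then show ?thesis using False by (auto simp: k_def)
  qed
  have k_id: "k y = y" if "y \<in> sphere 0 B" for y
    using that B(2) by (auto simp: k_def)
  have "retraction (cball 0 B) (sphere 0 B) (\<lambda>y. (B / norm (k y)) *\<^sub>R k y)"
    unfolding retraction_def
  proof (intro conjI ballI)
    show "continuous_on (cball 0 B) (\<lambda>y. (B / norm (k y)) *\<^sub>R k y)"
      by (intro continuous_intros contk) (use k_nz in auto)
    show "(\<lambda>y. (B / norm (k y)) *\<^sub>R k y) \<in> cball 0 B \<rightarrow> sphere 0 B"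
      using B(1) k_nz by auto
  qed (use B(1) k_id in auto)
  then show False
    using no_retraction_cball[OF B(1), of "0::'a"] by (auto simp: retract_of_def)
qed

text \<open>Without zeros other than 0, the unit sphere can be shrunk to radius \<epsilon> inside
  the domain where \<open>T\<close> is nonzero. There \<open>T\<close> is injective, and a
  nullhomotopy would give the zero-free extension just excluded.\<close>

lemma not_nullhomotopic_if_isolated_injective_zero:
  fixes T :: "'a::euclidean_space \<Rightarrow> 'a"
  assumes contT: "continuous_on (cball 0 1) T"
    and nz: "\<And>x. x \<in> cball 0 1 \<Longrightarrow> x \<noteq> 0 \<Longrightarrow> T x \<noteq> 0"
    and inj: "inj_on T (cball 0 \<epsilon>)" and \<epsilon>: "0 < \<epsilon>" "\<epsilon> \<le> 1" and T0: "T 0 = 0"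
  shows "\<not> homotopic_with_canon (\<lambda>_. True) (sphere 0 1) (- {0}) T (\<lambda>_. c)"
proof
  assume null: "homotopic_with_canon (\<lambda>_. True) (sphere 0 1) (- {0}) T (\<lambda>_. c)"
  define G where "G x = T (\<epsilon> *\<^sub>R x)" for x
  \<comment> \<open>\<open>s\<close> runs linearly through the radii from \<epsilon> to 1.\<close>
  define s where "s t = (1 - t) * \<epsilon> + t" for t :: real
  have s: "0 < s t" "s t \<le> 1" if "t \<in> {0..1}" for t
  proof -
    show "0 < s t" using that \<epsilon> unfolding s_def
      by (cases "t = 0") (auto intro: add_nonneg_pos)
    have "(1 - t) * \<epsilon> \<le> (1 - t) * 1" using that \<epsilon> by (intro mult_left_mono) auto
    then show "s t \<le> 1" by (simp add: s_def)
  qed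
  have "homotopic_with_canon (\<lambda>_. True) (sphere 0 1) (- {0}) G T"
    unfolding homotopic_with_def
  proof (intro exI conjI allI ballI)
    let ?h = "\<lambda>z. T (s (fst z) *\<^sub>R snd z)"
    have "continuous_on ({0..1} \<times> sphere 0 1) ?h"
    proof (rule continuous_on_compose2[OF contT])
      show "continuous_on ({0..1} \<times> sphere 0 1) (\<lambda>z. s (fst z) *\<^sub>R (snd z :: 'a))"
        unfolding s_def by (intro continuous_intros)
      show "(\<lambda>z. s (fst z) *\<^sub>R snd z) ` ({0..1} \<times> sphere 0 1) \<subseteq> cball (0::'a) 1"
        using s by (force simp: abs_of_pos)
    qed
    moreover have "?h ` ({0..1} \<times> sphere 0 1) \<subseteq> - {0}"
    proof clarsimp
      fix t and x :: 'a assume "0 \<le> t" "t \<le> 1" "norm x = 1" "T (s t *\<^sub>R x) = 0"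
      moreover have "x \<noteq> 0" using \<open>norm x = 1\<close> by auto
      ultimately show False using nz[of "s t *\<^sub>R x"] s[of t] by auto
    qed
    ultimately show "continuous_map (prod_topology (top_of_set {0..1}) (top_of_set (sphere 0 1)))
        (top_of_set (- {0})) ?h"
      by (simp flip: image_subset_iff_funcset subtopology_Times)
  qed (simp_all add: s_def G_def)
  with null have "homotopic_with_canon (\<lambda>_. True) (sphere 0 1) (- {0}) G (\<lambda>_. c)"
    by (rule homotopic_with_trans[rotated])
  then obtain h where h: "continuous_on (cball 0 1) h" "h ` cball 0 1 \<subseteq> - {0}"
      "\<forall>x\<in>sphere 0 1. h x = G x"
    using iffD1[OF nullhomotopic_from_sphere_extension exI] by metis
  have "continuous_on (cball 0 1) G"
    unfolding G_def
  proof (rule continuous_on_compose2[OF contT])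
    show "(*\<^sub>R) \<epsilon> ` cball 0 1 \<subseteq> cball (0::'a) 1"
      using \<epsilon> by (auto simp: mult_le_one)
  qed (intro continuous_intros)
  moreover have "inj_on G (cball 0 1)"
  proof (rule inj_onI)
    fix x y assume "x \<in> cball 0 1" "y \<in> cball 0 (1::real)" "G x = G y"
    then have "\<epsilon> *\<^sub>R x = \<epsilon> *\<^sub>R y"
      using \<epsilon> by (intro inj_onD[OF inj, of "\<epsilon> *\<^sub>R x" "\<epsilon> *\<^sub>R y"]) (simp_all add: G_def)
    then show "x = y" using \<epsilon> by simp
  qed
  moreover have "h x \<noteq> 0" if "x \<in> cball 0 1" for x
    using h(2) that by auto
  moreover have "G 0 = 0" using T0 by (simp add: G_def)
  ultimately show False
    using injective_no_zero_free_extension[of 1 G h] h(1,3) by auto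
qed

section \<open>Recession cones\<close>

text \<open>Asymptotic directions become rays from one base point: \<open>y + l *\<^sub>R u\<close>
  is the limit of convex combinations of \<open>y\<close> and \<open>x k\<close> with weight
  \<open>l / t k\<close> on \<open>x k\<close>. Conversely, points far out on the ray serve as the
  sequence.\<close>

lemma recession_cone_iff:
  fixes K :: "'a::euclidean_space set"
  assumes K: "closed K" "convex K" and y: "y \<in> K"
  shows "u \<in> recession_cone K \<longleftrightarrow> (\<forall>l\<ge>0. y + l *\<^sub>R u \<in> K)"
proof (intro iffI allI impI)
  fix l :: real assume u: "u \<in> recession_cone K" and l: "0 \<le> l"
  then obtain t x where tx: "filterlim t at_top sequentially" "\<And>k::nat. x k \<in> K"
      "(\<lambda>k. x k /\<^sub>R t k) \<longlonglongrightarrow> u"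
    unfolding recession_cone_def by blast
  have t0: "(\<lambda>k. inverse (t k)) \<longlonglongrightarrow> 0"
    using tx(1) by (rule tendsto_inverse_0_at_top)
  have "(\<lambda>k. (1 - l * inverse (t k)) *\<^sub>R y + l *\<^sub>R (x k /\<^sub>R t k))
      \<longlonglongrightarrow> (1 - l * 0) *\<^sub>R y + l *\<^sub>R u"
    by (intro tendsto_intros t0 tx(3))
  moreover have "\<forall>\<^sub>F k in sequentially.
      (1 - l * inverse (t k)) *\<^sub>R y + l *\<^sub>R (x k /\<^sub>R t k) \<in> K"
    using tx(1)[unfolded filterlim_at_top_dense, rule_format, of l]
  proof eventually_elim
    case (elim k)
    have "l * inverse (t k) \<le> 1" "0 \<le> l * inverse (t k)"
      using elim l by (auto simp: field_simps)
    then have "(1 - l * inverse (t k)) *\<^sub>R y + (l * inverse (t k)) *\<^sub>R x k \<in> K"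
      by (intro convexD[OF K(2) y tx(2)]) auto
    then show ?case by simp
  qed
  ultimately have "(1 - l * 0) *\<^sub>R y + l *\<^sub>R u \<in> K"
    by (intro Lim_in_closed_set[OF K(1) _ sequentially_bot])
  then show "y + l *\<^sub>R u \<in> K" by simp
next
  assume u: "\<forall>l\<ge>0. y + l *\<^sub>R u \<in> K"
  define t where "t k = real (Suc k)" for k
  have t: "filterlim t at_top sequentially"
    unfolding t_def by (rule filterlim_compose[OF filterlim_real_sequentially filterlim_Suc])
  have "(\<lambda>k. inverse (t k) *\<^sub>R y + u) \<longlonglongrightarrow> 0 *\<^sub>R y + u"
    by (intro tendsto_intros tendsto_inverse_0_at_top t)
  moreover have "(y + t k *\<^sub>R u) /\<^sub>R t k = inverse (t k) *\<^sub>R y + u" for k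
    by (simp add: scaleR_add_right t_def)
  ultimately have "(\<lambda>k. (y + t k *\<^sub>R u) /\<^sub>R t k) \<longlonglongrightarrow> u" by simp
  moreover have "y + t k *\<^sub>R u \<in> K" for k using u by (simp add: t_def)
  ultimately show "u \<in> recession_cone K"
    unfolding recession_cone_def using t by (intro CollectI exI conjI allI)
qed

lemma
  fixes K :: "'a::euclidean_space set"
  assumes K: "closed K" "convex K" "K \<noteq> {}"
  shows closed_recession_cone: "closed (recession_cone K)"
    and convex_cone_recession_cone: "convex_cone (recession_cone K)"
proof -
  obtain y where y: "y \<in> K" using K(3) by blast
  note iff = recession_cone_iff[OF K(1,2) y]
  have "recession_cone K = (\<Inter>l\<in>{0..}. (\<lambda>u. y + l *\<^sub>R u) -` K)"
    using iff by auto
  moreover have "closed ((\<lambda>u. y + l *\<^sub>R u) -` K)" for l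
    by (intro continuous_closed_vimage K(1)) (auto intro!: continuous_intros)
  ultimately show "closed (recession_cone K)" by auto
  show "convex_cone (recession_cone K)"
    unfolding convex_cone_iff
  proof (intro conjI ballI allI impI)
    show "0 \<in> recession_cone K" using y by (simp add: iff)
    fix u assume u: "u \<in> recession_cone K"
    show "c *\<^sub>R u \<in> recession_cone K" if "0 \<le> c" for c
      using u that by (simp add: iff)
    fix v assume v: "v \<in> recession_cone K"
    have "y + l *\<^sub>R (u + v) \<in> K" if "0 \<le> l" for l
    proof -
      \<comment> \<open>The midpoint of the two ray points at the doubled parameter is the ray point
        of \<open>u + v\<close> at \<open>l\<close>.\<close>
      have "(1/2) *\<^sub>R (y + (2 * l) *\<^sub>R u) + (1/2) *\<^sub>R (y + (2 * l) *\<^sub>R v) \<in> K"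
        using u v that by (intro convexD[OF K(2)]) (simp_all add: iff)
      moreover have "(1/2) *\<^sub>R (y + (2 * l) *\<^sub>R u) + (1/2) *\<^sub>R (y + (2 * l) *\<^sub>R v)
          = ((1/2) *\<^sub>R y + (1/2) *\<^sub>R y) + l *\<^sub>R (u + v)"
        by (simp add: scaleR_add_right add_ac)
      moreover have "(1/2) *\<^sub>R y + (1/2) *\<^sub>R y = y"
        by (simp flip: scaleR_add_left)
      ultimately show ?thesis by metis
    qed
    then show "u + v \<in> recession_cone K" by (simp add: iff)
  qed
qed

lemma recession_cone_closed_convex_cone:
  fixes S :: "'a::euclidean_space set"
  assumes "convex_cone S" "closed S"
  shows "recession_cone S = S"
proof -
  have "u \<in> recession_cone S \<longleftrightarrow> (\<forall>l\<ge>0. 0 + l *\<^sub>R u \<in> S)" for u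
    using assms by (intro recession_cone_iff) (auto simp: convex_cone_def convex_cone_contains_0)
  also have "\<dots> u \<longleftrightarrow> u \<in> S" for u
    using convex_cone_scaleR[OF assms(1)] by (auto dest: spec[of _ 1])
  finally show ?thesis by blast
qed

lemma recession_cone_subset:
  fixes C :: "'a::euclidean_space set"
  assumes "convex_cone C" "closed C" "K \<subseteq> C"
  shows "recession_cone K \<subseteq> C"
proof -
  have "recession_cone K \<subseteq> recession_cone C"
    using assms(3) by (fastforce simp: recession_cone_def)
  then show ?thesis using recession_cone_closed_convex_cone[OF assms(1,2)] by simp
qed

lemma limit_of_rescaled_mem_recession_cone:
  fixes K :: "'a::real_normed_vector set" and s :: "nat \<Rightarrow> real"
  assumes s: "filterlim s at_top sequentially" "\<And>k. s k > 0"
    and w: "\<And>k. w k \<in> (*\<^sub>R) (inverse (s k)) ` K" "w \<longlonglongrightarrow> l"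
  shows "l \<in> recession_cone K"
proof -
  have "s k *\<^sub>R w k \<in> K" for k
    using w(1)[of k] s(2)[of k] by auto
  moreover have "(s k *\<^sub>R w k) /\<^sub>R s k = w k" for k
    using s(2)[of k] by simp
  ultimately show ?thesis
    unfolding recession_cone_def using s(1) w(2)
    by (auto intro!: exI[of _ s] exI[of _ "\<lambda>k. s k *\<^sub>R w k"])
qed

section \<open>Natural maps\<close>

definition natural_map :: "('a::euclidean_space \<Rightarrow> 'a) \<Rightarrow> ('a \<Rightarrow> 'a) \<Rightarrow> 'a set \<Rightarrow> 'a \<Rightarrow> 'a" where
  "natural_map \<phi> \<psi> S x = \<psi> x - closest_point S (\<psi> x - \<phi> x)"

text \<open>For the converse, expanding the squared distance from \<open>a\<close> to
  \<open>y\<close> about \<open>x\<close> adds a square and a cross term that the inequality makes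
  nonnegative.\<close>

lemma closest_point_eq_iff:
  fixes S :: "'a::euclidean_space set"
  assumes S: "convex S" "closed S" "S \<noteq> {}"
  shows "closest_point S a = x \<longleftrightarrow> x \<in> S \<and> (\<forall>y\<in>S. (a - x) \<bullet> (y - x) \<le> 0)"
proof
  assume "closest_point S a = x"
  then show "x \<in> S \<and> (\<forall>y\<in>S. (a - x) \<bullet> (y - x) \<le> 0)"
    using closest_point_in_set[OF S(2,3), of a] closest_point_dot[OF S(1,2), of _ a] by auto
next
  assume x: "x \<in> S \<and> (\<forall>y\<in>S. (a - x) \<bullet> (y - x) \<le> 0)"
  have "dist a x \<le> dist a y" if "y \<in> S" for y
  proof -
    have "(norm (a - y))\<^sup>2 = (norm (a - x))\<^sup>2 + (norm (y - x))\<^sup>2 - 2 * ((a - x) \<bullet> (y - x))"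
      by (simp add: power2_norm_eq_inner inner_diff inner_commute algebra_simps)
    moreover have "(a - x) \<bullet> (y - x) \<le> 0" using x that by blast
    ultimately have "(norm (a - x))\<^sup>2 \<le> (norm (a - y))\<^sup>2"
      using zero_le_power2[of "norm (y - x)"] by linarith
    then show ?thesis by (simp add: dist_norm power2_le_iff_abs_le)
  qed
  with x show "closest_point S a = x"
    using closest_point_unique[OF S(1,2)] by metis
qed

lemma natural_map_eq_0_iff:
  assumes "convex S" "closed S" "S \<noteq> {}"
  shows "natural_map \<phi> \<psi> S x = 0 \<longleftrightarrow> x \<in> GVI_SOL UNIV \<phi> \<psi> S"
proof -
  have "natural_map \<phi> \<psi> S x = 0 \<longleftrightarrow> closest_point S (\<psi> x - \<phi> x) = \<psi> x"
    by (auto simp: natural_map_def)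
  then show ?thesis
    by (simp add: closest_point_eq_iff[OF assms] GVI_SOL_def)
qed

lemma continuous_on_natural_map:
  assumes "convex S" "closed S" "S \<noteq> {}" "continuous_on A \<phi>" "continuous_on A \<psi>"
  shows "continuous_on A (natural_map \<phi> \<psi> S)"
  unfolding natural_map_def
  by (intro continuous_intros assms
      continuous_on_compose2[OF continuous_on_closest_point[OF assms(1-3), of UNIV]]) auto

section \<open>Leading terms\<close>

text \<open>The normalisation leaves a positively homogeneous mapping of degree \<delta> on the
  whole space unchanged for every \<open>R > 0\<close>.\<close>

definition rescale :: "real \<Rightarrow> real \<Rightarrow> ('a::real_normed_vector \<Rightarrow> 'a) \<Rightarrow> 'a \<Rightarrow> 'a" where
  "rescale \<delta> R \<phi> x = \<phi> (R *\<^sub>R x) /\<^sub>R (R powr \<delta>)"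

lemma continuous_on_rescale:
  assumes "continuous_on UNIV \<phi>"
  shows "continuous_on A (rescale \<delta> R \<phi>)"
  unfolding rescale_def
  by (intro continuous_intros continuous_on_compose2[OF assms]) auto

text \<open>The two factors may differ: if the set shrinks with \<psi>, the inner product in the
  inequality is only multiplied by the product of two positive numbers.\<close>

lemma GVI_SOL_rescale:
  assumes "R > 0"
  shows "x \<in> GVI_SOL UNIV (rescale \<delta>1 R \<phi>) (rescale \<delta>2 R \<psi>) ((*\<^sub>R) (inverse (R powr \<delta>2)) ` S)
    \<longleftrightarrow> R *\<^sub>R x \<in> GVI_SOL UNIV \<phi> \<psi> S"
proof -
  define a b where "a = inverse (R powr \<delta>1)" and "b = inverse (R powr \<delta>2)"
  have pos: "a > 0" "b > 0" using assms by (simp_all add: a_def b_def)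
  have "0 \<le> (a *\<^sub>R u) \<bullet> (b *\<^sub>R y - b *\<^sub>R v) \<longleftrightarrow> 0 \<le> u \<bullet> (y - v)" for u y v :: 'a
  proof -
    have eq: "(a *\<^sub>R u) \<bullet> (b *\<^sub>R y - b *\<^sub>R v) = (a * b) * (u \<bullet> (y - v))"
      by (simp flip: scaleR_diff_right)
    show ?thesis
      unfolding eq using mult_le_cancel_left_pos[OF mult_pos_pos[OF pos], of 0 "u \<bullet> (y - v)"] by simp
  qed
  moreover have "b *\<^sub>R v \<in> (*\<^sub>R) b ` S \<longleftrightarrow> v \<in> S" for v
    using pos by (auto simp: image_iff)
  ultimately show ?thesis
    unfolding GVI_SOL_def rescale_def a_def[symmetric] b_def[symmetric] by (auto simp del: inner_scaleR_left)
qed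

text \<open>The remainder is determined on \<open>D\<close> as \<open>\<phi> - h\<close>, so the
  existential disappears and its continuity turns into continuity of \<phi>.\<close>

lemma leading_term_on_iff:
  "leading_term_on D \<delta> \<phi> h \<longleftrightarrow>
    continuous_on D h \<and> (\<forall>x\<in>D. \<forall>l>0. h (l *\<^sub>R x) = (l powr \<delta>) *\<^sub>R h x) \<and> continuous_on D \<phi> \<and>
    ((\<lambda>x. (\<phi> x - h x) /\<^sub>R (norm x powr \<delta>)) \<longlongrightarrow> 0) (inf at_infinity (principal D))"
    (is "_ \<longleftrightarrow> ?rhs")
proof
  assume lt: "leading_term_on D \<delta> \<phi> h"
  then obtain e where h: "continuous_on D h" and e: "continuous_on D e"
      and eq: "\<forall>x\<in>D. \<phi> x = h x + e x"
      and lim: "((\<lambda>x. e x /\<^sub>R (norm x powr \<delta>)) \<longlongrightarrow> 0) (inf at_infinity (principal D))"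
    unfolding leading_term_on_def positively_homogeneous_on_def by blast
  have "continuous_on D (\<lambda>x. h x + e x)" by (intro continuous_intros h e)
  then have "continuous_on D \<phi>" using eq by (simp cong: continuous_on_cong)
  moreover have "((\<lambda>x. (\<phi> x - h x) /\<^sub>R (norm x powr \<delta>)) \<longlongrightarrow> 0) (inf at_infinity (principal D))"
    by (rule Lim_transform_eventually[OF lim])
      (use eq in \<open>simp add: eventually_inf_principal\<close>)
  ultimately show ?rhs
    using lt unfolding leading_term_on_def positively_homogeneous_on_def by blast
next
  assume rhs: ?rhs
  moreover have "continuous_on D (\<lambda>x. \<phi> x - h x)"
    using rhs by (intro continuous_intros) auto
  ultimately show "leading_term_on D \<delta> \<phi> h"
    unfolding leading_term_on_def positively_homogeneous_on_def
    by (intro conjI exI[of _ "\<lambda>x. \<phi> x - h x"]) auto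
qed

lemma filterlim_powr_at_top:
  fixes \<delta> :: real
  assumes "\<delta> > 0"
  shows "filterlim (\<lambda>x. x powr \<delta>) at_top at_top"
proof -
  have "filterlim (\<lambda>x. exp (\<delta> * ln x)) at_top at_top"
    by (intro filterlim_compose[OF exp_at_top]
        filterlim_tendsto_pos_mult_at_top[OF tendsto_const assms ln_at_top])
  moreover have "\<forall>\<^sub>F x in at_top. exp (\<delta> * ln x) = x powr \<delta>"
    using eventually_gt_at_top[of 0] by eventually_elim (simp add: powr_def)
  ultimately show ?thesis by (simp cong: filterlim_cong)
qed

lemma leading_term_on_zero:
  assumes "leading_term_on D \<delta> \<phi> h" "\<delta> > 0" "0 \<in> D"
  shows "h 0 = 0"
proof -
  have "h (2 *\<^sub>R 0) = (2 powr \<delta>) *\<^sub>R h 0"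
    using assms(1,3) unfolding leading_term_on_iff by (metis zero_less_numeral)
  then have "(2 powr \<delta> - 1) *\<^sub>R h 0 = 0"
    by (simp add: scaleR_diff_left)
  moreover have "2 powr \<delta> \<noteq> 1" using assms(2) by simp
  ultimately show ?thesis by simp
qed

lemma leading_term_on_self:
  "leading_term_on D \<delta> \<phi> h \<Longrightarrow> leading_term_on D \<delta> h h"
  by (simp add: leading_term_on_iff)

lemma leading_term_on_add_const:
  fixes \<phi> :: "'a::euclidean_space \<Rightarrow> 'a"
  assumes "leading_term_on D \<delta> \<phi> h" "\<delta> > 0"
  shows "leading_term_on D \<delta> (\<lambda>x. \<phi> x + c) h"
proof -
  let ?F = "inf at_infinity (principal D)"
  have lim: "((\<lambda>x. (\<phi> x - h x) /\<^sub>R (norm x powr \<delta>)) \<longlongrightarrow> 0) ?F"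
    and cont: "continuous_on D \<phi>"
    using assms(1) by (simp_all add: leading_term_on_iff)
  have "((\<lambda>x::'a. inverse (norm x powr \<delta>)) \<longlongrightarrow> 0) at_infinity"
    by (intro tendsto_inverse_0_at_top filterlim_compose[OF filterlim_powr_at_top[OF assms(2)]]
        filterlim_norm_at_top)
  then have "((\<lambda>x. inverse (norm x powr \<delta>)) \<longlongrightarrow> 0) ?F"
    by (rule tendsto_mono[rotated]) simp
  then have "((\<lambda>x. (\<phi> x - h x) /\<^sub>R (norm x powr \<delta>) + inverse (norm x powr \<delta>) *\<^sub>R c)
      \<longlongrightarrow> 0 + 0 *\<^sub>R c) ?F"
    by (intro tendsto_intros lim)
  then have "((\<lambda>x. (\<phi> x + c - h x) /\<^sub>R (norm x powr \<delta>)) \<longlongrightarrow> 0) ?F"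
    by (simp add: algebra_simps)
  moreover have "continuous_on D (\<lambda>x. \<phi> x + c)" by (intro continuous_intros cont)
  ultimately show ?thesis
    using assms(1) by (simp add: leading_term_on_iff)
qed

text \<open>On unit vectors the norm of \<open>R k *\<^sub>R x k\<close> is exactly
  \<open>R k\<close>, so the rescaled remainder is the quotient that tends to 0. Letting the point
  vary with the radius is what later yields uniformity on the sphere.\<close>

lemma leading_term_rescale_tendsto:
  fixes \<phi> :: "'a::real_normed_vector \<Rightarrow> 'a" and R :: "nat \<Rightarrow> real"
  assumes lt: "leading_term_on UNIV \<delta> \<phi> h"
    and R: "filterlim R at_top sequentially" "\<And>k. R k > 0"
    and x: "\<And>k. norm (x k) = 1" "x \<longlonglongrightarrow> a"
  shows "(\<lambda>k. rescale \<delta> (R k) \<phi> (x k)) \<longlonglongrightarrow> h a"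
proof -
  let ?e = "\<lambda>x. \<phi> x - h x"
  have h: "continuous_on UNIV h" and hom: "\<And>x l. l > 0 \<Longrightarrow> h (l *\<^sub>R x) = (l powr \<delta>) *\<^sub>R h x"
    and e: "((\<lambda>x. ?e x /\<^sub>R (norm x powr \<delta>)) \<longlongrightarrow> 0) at_infinity"
    using lt by (simp_all add: leading_term_on_iff)
  have n: "norm (R k *\<^sub>R x k) = R k" for k using R(2)[of k] x(1)[of k] by simp
  have "filterlim (\<lambda>k. R k *\<^sub>R x k) at_infinity sequentially"
    unfolding filterlim_at_infinity_conv_norm_at_top n by (rule R(1))
  then have "(\<lambda>k. ?e (R k *\<^sub>R x k) /\<^sub>R (norm (R k *\<^sub>R x k) powr \<delta>)) \<longlonglongrightarrow> 0"
    by (rule filterlim_compose[OF e])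
  moreover have "(\<lambda>k. h (x k)) \<longlonglongrightarrow> h a"
    by (rule continuous_on_tendsto_compose[OF h x(2)]) auto
  ultimately have "(\<lambda>k. h (x k) + ?e (R k *\<^sub>R x k) /\<^sub>R (R k powr \<delta>)) \<longlonglongrightarrow> h a + 0"
    unfolding n by (intro tendsto_add)
  moreover have "rescale \<delta> (R k) \<phi> (x k) = h (x k) + ?e (R k *\<^sub>R x k) /\<^sub>R (R k powr \<delta>)" for k
    using R(2)[of k] by (simp add: rescale_def hom scaleR_diff_right)
  ultimately show ?thesis by simp
qed

section \<open>Extension of mappings from a cone by projection\<close>

lemma closest_point_cone_scaleR:
  fixes C :: "'a::euclidean_space set"
  assumes C: "convex_cone C" "closed C" and l: "l > 0"
  shows "closest_point C (l *\<^sub>R x) = l *\<^sub>R closest_point C x"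
proof -
  have C': "convex C" "C \<noteq> {}" using C(1) by (auto simp: convex_cone_def)
  have cp: "closest_point C x \<in> C" "(x - closest_point C x) \<bullet> (y - closest_point C x) \<le> 0"
    if "y \<in> C" for y
    using closest_point_in_set[OF C(2) C'(2)] closest_point_dot[OF C'(1) C(2) that] by auto
  have "(l *\<^sub>R x - l *\<^sub>R closest_point C x) \<bullet> (y - l *\<^sub>R closest_point C x) \<le> 0" if y: "y \<in> C" for y
  proof -
    \<comment> \<open>The projection inequality for \<open>x\<close>, tested at \<open>y / l\<close>
      and multiplied by the square of \<open>l\<close>, is the one for \<open>l *\<^sub>R x\<close>
      tested at \<open>y\<close>.\<close>
    have "inverse l *\<^sub>R y \<in> C" using y l by (intro convex_cone_scaleR[OF C(1)]) auto
    from cp(2)[OF this]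
    have "l\<^sup>2 * ((x - closest_point C x) \<bullet> (inverse l *\<^sub>R y - closest_point C x)) \<le> 0"
      by (simp add: mult_le_0_iff)
    also have "l\<^sup>2 * ((x - closest_point C x) \<bullet> (inverse l *\<^sub>R y - closest_point C x))
        = (l *\<^sub>R (x - closest_point C x)) \<bullet> (l *\<^sub>R (inverse l *\<^sub>R y - closest_point C x))"
      by (simp only: inner_scaleR_left inner_scaleR_right power2_eq_square mult.assoc)
    also have "\<dots> = (l *\<^sub>R x - l *\<^sub>R closest_point C x) \<bullet> (y - l *\<^sub>R closest_point C x)"
      using l by (simp add: scaleR_diff_right)
    finally show ?thesis .
  qed
  moreover have "l *\<^sub>R closest_point C x \<in> C"
    using cp(1) C'(2) l by (intro convex_cone_scaleR[OF C(1)]) auto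
  ultimately show ?thesis
    by (subst closest_point_eq_iff[OF C'(1) C(2) C'(2)]) blast
qed

text \<open>The projection commutes with positive scaling, which preserves homogeneity. It may stay
  bounded while \<open>x\<close> tends to infinity, so the remainder is treated in two cases: where
  the projection is large its decay applies, since projecting does not increase the norm; elsewhere
  it is bounded by compactness and negligible against \<open>norm x powr \<delta>\<close>.\<close>

lemma leading_term_on_compose_closest_point:
  fixes C :: "'a::euclidean_space set"
  assumes C: "convex_cone C" "closed C" and \<delta>: "\<delta> > 0" and lt: "leading_term_on C \<delta> \<phi> h"
  shows "leading_term_on UNIV \<delta> (\<phi> \<circ> closest_point C) (h \<circ> closest_point C)"
proof -
  let ?P = "closest_point C" and ?e = "\<lambda>x. \<phi> x - h x"
  have C': "convex C" "C \<noteq> {}" "0 \<in> C" using C(1) by (auto simp: convex_cone_def convex_cone_contains_0)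
  have P: "?P x \<in> C" for x using closest_point_in_set[OF C(2) C'(2)] .
  have contP: "continuous_on UNIV ?P" using continuous_on_closest_point[OF C'(1) C(2) C'(2)] .
  have nP: "norm (?P x) \<le> norm x" for x
    using closest_point_lipschitz[OF C'(1) C(2) C'(2), of x 0] closest_point_self[OF C'(3)] by simp
  have h: "continuous_on C h" and hom: "\<And>x l. x \<in> C \<Longrightarrow> l > 0 \<Longrightarrow> h (l *\<^sub>R x) = (l powr \<delta>) *\<^sub>R h x"
    and \<phi>: "continuous_on C \<phi>"
    and lim: "((\<lambda>x. ?e x /\<^sub>R (norm x powr \<delta>)) \<longlongrightarrow> 0) (inf at_infinity (principal C))"
    using lt by (simp_all add: leading_term_on_iff)
  have lim': "((\<lambda>x. ?e (?P x) /\<^sub>R (norm x powr \<delta>)) \<longlongrightarrow> 0) at_infinity"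
    unfolding tendsto_iff
  proof (intro allI impI)
    fix \<epsilon> :: real assume \<epsilon>: "0 < \<epsilon>"
    obtain B where *: "\<And>y. y \<in> C \<Longrightarrow> B \<le> norm y \<Longrightarrow> norm (?e y /\<^sub>R (norm y powr \<delta>)) < \<epsilon>"
      using lim[unfolded tendsto_iff eventually_inf_principal eventually_at_infinity, rule_format, OF \<epsilon>]
      unfolding dist_norm diff_zero by metis
    then have B: "norm (?e y) < \<epsilon> * norm y powr \<delta>" if "y \<in> C" "max 0 B < norm y" for y
    proof -
      have "norm (?e y /\<^sub>R (norm y powr \<delta>)) < \<epsilon>" "0 < norm y powr \<delta>"
        using *[OF that(1)] that(2) by simp_all
      then show ?thesis unfolding norm_scaleR by (simp add: field_simps)
    qed
    have "compact (?e ` (C \<inter> cball 0 (max 0 B)))"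
      by (intro compact_continuous_image continuous_intros closed_Int_compact C(2) compact_cball
          continuous_on_subset[OF h] continuous_on_subset[OF \<phi>]) auto
    then obtain M where M: "\<And>y. y \<in> C \<Longrightarrow> norm y \<le> max 0 B \<Longrightarrow> norm (?e y) \<le> M"
      using compact_imp_bounded bounded_iff by (metis (no_types, lifting) IntI imageI mem_cball_0)
    have "filterlim (\<lambda>x::'a. norm x powr \<delta>) at_top at_infinity"
      by (intro filterlim_compose[OF filterlim_powr_at_top[OF \<delta>]] filterlim_norm_at_top)
    then have "\<forall>\<^sub>F x::'a in at_infinity. max 0 (M / \<epsilon>) < norm x powr \<delta>"
      unfolding filterlim_at_top_dense by blast
    then show "\<forall>\<^sub>F x in at_infinity. dist (?e (?P x) /\<^sub>R (norm x powr \<delta>)) 0 < \<epsilon>"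
    proof eventually_elim
      case (elim x)
      then have pos: "0 < norm x powr \<delta>" and Mx: "M < \<epsilon> * norm x powr \<delta>"
        using \<epsilon> by (simp_all add: field_simps)
      have "norm (?e (?P x)) < \<epsilon> * norm x powr \<delta>"
      proof (cases "norm (?P x) \<le> max 0 B")
        case True
        then show ?thesis using M[OF P] Mx by fastforce
      next
        case False
        then have "norm (?e (?P x)) < \<epsilon> * norm (?P x) powr \<delta>"
          by (intro B P) (simp only: not_le)
        also have "\<dots> \<le> \<epsilon> * norm x powr \<delta>"
          using \<epsilon> \<delta> nP by (intro mult_left_mono powr_mono2) auto
        finally show ?thesis .
      qed
      then show ?case using pos unfolding dist_norm diff_zero norm_scaleR by (simp add: field_simps)
    qed
  qed
  have "continuous_on UNIV (\<phi> \<circ> ?P)" "continuous_on UNIV (h \<circ> ?P)"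
    unfolding o_def using P
    by (auto intro!: continuous_on_compose2[OF \<phi> contP] continuous_on_compose2[OF h contP])
  then show ?thesis
    using lim' P by (simp add: leading_term_on_iff closest_point_cone_scaleR[OF C] hom)
qed

section \<open>Solutions of problems with given leading terms\<close>

text \<open>The projections are bounded, and their cluster points lie in the recession cone. Such a
  point is closest to \<open>a\<close> because every \<open>v\<close> in the cone is the limit of
  the competitors \<open>inverse (s k) *\<^sub>R y + v\<close> from the shrunken sets. A subsequence
  suffices for the later argument by contradiction.\<close>

lemma closest_point_rescaled_set_tendsto:
  fixes S :: "'a::euclidean_space set" and s :: "nat \<Rightarrow> real"
  assumes S: "convex S" "closed S" "S \<noteq> {}"
    and s: "filterlim s at_top sequentially" "\<And>k. s k > 0"
    and z: "z \<longlonglongrightarrow> a"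
  shows "\<exists>r. strict_mono r \<and>
    (\<lambda>k. closest_point ((*\<^sub>R) (inverse (s (r k))) ` S) (z (r k)))
      \<longlonglongrightarrow> closest_point (recession_cone S) a"
proof -
  let ?S = "\<lambda>k. (*\<^sub>R) (inverse (s k)) ` S"
  define P where "P k = closest_point (?S k) (z k)" for k
  obtain y where y: "y \<in> S" using S(3) by blast
  have cl: "closed (?S k)" for k by (intro closed_scaling S(2))
  have P_in: "P k \<in> ?S k" for k
    unfolding P_def using S(3) by (intro closest_point_in_set cl) auto
  have P_le: "dist (z k) (P k) \<le> dist (z k) w" if "w \<in> ?S k" for w k
    unfolding P_def by (intro closest_point_le cl that)
  have s0: "(\<lambda>k. inverse (s k)) \<longlonglongrightarrow> 0"
    using s(1) by (rule tendsto_inverse_0_at_top)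
  have "bounded (range z)" "bounded (range (\<lambda>k. inverse (s k) *\<^sub>R y))"
    by (rule convergent_imp_bounded[OF z],
        rule convergent_imp_bounded[OF tendsto_scaleR[OF s0 tendsto_const]])
  then obtain M N where M: "\<And>k. norm (z k) \<le> M" and N: "\<And>k. norm (inverse (s k) *\<^sub>R y) \<le> N"
    unfolding bounded_iff by auto
  have "norm (P k) \<le> 2 * M + N" for k
  proof -
    \<comment> \<open>The scaled copy of the fixed point \<open>y\<close> is a competitor that
      bounds the projections uniformly.\<close>
    have "dist (z k) (P k) \<le> dist (z k) (inverse (s k) *\<^sub>R y)"
      using y by (intro P_le) auto
    moreover have "dist (z k) (inverse (s k) *\<^sub>R y) \<le> M + N"
      using norm_triangle_ineq4[of "z k" "inverse (s k) *\<^sub>R y"] M[of k] N[of k]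
      unfolding dist_norm by linarith
    moreover have "norm (P k) \<le> norm (z k) + dist (z k) (P k)"
      using norm_triangle_ineq4[of "z k" "z k - P k"] by (simp add: dist_norm)
    ultimately show ?thesis using M[of k] by linarith
  qed
  then have "bounded (range P)" unfolding bounded_iff by blast
  then obtain l r where r: "strict_mono r" "(P \<circ> r) \<longlonglongrightarrow> l"
    using bounded_imp_convergent_subsequence by blast
  have sr: "filterlim (\<lambda>k. s (r k)) at_top sequentially"
    by (rule filterlim_compose[OF s(1) filterlim_subseq[OF r(1)]])
  have l_in: "l \<in> recession_cone S"
    by (rule limit_of_rescaled_mem_recession_cone[OF sr, of "P \<circ> r"]) (use s(2) P_in r(2) in auto)
  have zr: "(\<lambda>k. z (r k)) \<longlonglongrightarrow> a"
    using LIMSEQ_subseq_LIMSEQ[OF z r(1)] by (simp add: o_def)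
  have "dist a l \<le> dist a v" if v: "v \<in> recession_cone S" for v
  proof (rule tendsto_le[OF sequentially_bot])
    show "(\<lambda>k. dist (z (r k)) (P (r k))) \<longlonglongrightarrow> dist a l"
      using r(2) by (intro tendsto_dist zr) (simp add: o_def)
    have "(\<lambda>k. inverse (s (r k)) *\<^sub>R y + v) \<longlonglongrightarrow> 0 *\<^sub>R y + v"
      by (intro tendsto_intros tendsto_inverse_0_at_top sr)
    then show "(\<lambda>k. dist (z (r k)) (inverse (s (r k)) *\<^sub>R y + v)) \<longlonglongrightarrow> dist a v"
      by (intro tendsto_dist zr) simp
    have "inverse (s k) *\<^sub>R y + v \<in> ?S k" for k
    proof (rule image_eqI)
      show "y + s k *\<^sub>R v \<in> S"
        using v s(2)[of k] by (simp add: recession_cone_iff[OF S(2,1) y])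
      show "inverse (s k) *\<^sub>R y + v = inverse (s k) *\<^sub>R (y + s k *\<^sub>R v)"
        using s(2)[of k] by (simp add: scaleR_add_right)
    qed
    then show "\<forall>\<^sub>F k in sequentially.
        dist (z (r k)) (P (r k)) \<le> dist (z (r k)) (inverse (s (r k)) *\<^sub>R y + v)"
      using P_le by simp
  qed
  then have "l = closest_point (recession_cone S) a"
    using l_in closed_recession_cone[OF S(2,1,3)] convex_cone_recession_cone[OF S(2,1,3)]
    by (intro closest_point_unique) (auto simp: convex_cone_def)
  then show ?thesis using r by (auto simp: P_def o_def)
qed

text \<open>A failure would give radii tending to infinity and unit vectors with a cluster point
  \<open>a\<close> at which the limiting natural map vanishes, although only 0 may solve the
  limiting problem. Measuring closeness against the norm of the limit makes both maps nonzero and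
  permits a straight-line homotopy.\<close>

lemma eventually_rescaled_natural_map_close:
  fixes \<phi> \<psi> \<phi>0 \<psi>0 :: "'a::euclidean_space \<Rightarrow> 'a"
  assumes S: "convex S" "closed S" "S \<noteq> {}"
    and \<phi>: "leading_term_on UNIV \<delta>1 \<phi> \<phi>0" and \<psi>: "leading_term_on UNIV \<delta>2 \<psi> \<psi>0"
    and \<delta>2: "\<delta>2 > 0"
    and sol: "GVI_SOL UNIV \<phi>0 \<psi>0 (recession_cone S) \<subseteq> {0}"
  shows "\<forall>\<^sub>F R in at_top. \<forall>x\<in>sphere 0 1.
    dist (natural_map (rescale \<delta>1 R \<phi>) (rescale \<delta>2 R \<psi>) ((*\<^sub>R) (inverse (R powr \<delta>2)) ` S) x)
         (natural_map \<phi>0 \<psi>0 (recession_cone S) x)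
      < norm (natural_map \<phi>0 \<psi>0 (recession_cone S) x)"
proof (rule ccontr)
  let ?N = "\<lambda>R. natural_map (rescale \<delta>1 R \<phi>) (rescale \<delta>2 R \<psi>) ((*\<^sub>R) (inverse (R powr \<delta>2)) ` S)"
    and ?L = "natural_map \<phi>0 \<psi>0 (recession_cone S)"
  assume "\<not> ?thesis"
  then have "\<exists>R>B. \<exists>x\<in>sphere 0 1. \<not> dist (?N R x) (?L x) < norm (?L x)" for B
    unfolding eventually_at_top_dense by blast
  \<comment> \<open>The bound \<open>Suc k\<close> makes the radii positive and drives them to
    infinity.\<close>
  then have "\<exists>R x. real (Suc k) < R \<and> norm x = 1 \<and> norm (?L x) \<le> dist (?N R x) (?L x)" for k
    unfolding not_less Bex_def mem_sphere_0 by blast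
  then obtain R x where "\<forall>k. real (Suc k) < R k \<and> norm (x k) = 1 \<and>
      norm (?L (x k)) \<le> dist (?N (R k) (x k)) (?L (x k))"
    by metis
  then have R: "\<And>k. real (Suc k) < R k" and x: "\<And>k. norm (x k) = 1"
    and far: "\<And>k. norm (?L (x k)) \<le> dist (?N (R k) (x k)) (?L (x k))"
    by blast+
  have cone: "convex (recession_cone S)" "closed (recession_cone S)" "recession_cone S \<noteq> {}"
    using closed_recession_cone[OF S(2,1,3)] convex_cone_recession_cone[OF S(2,1,3)]
    by (auto simp: convex_cone_def)
  have "\<forall>k. x k \<in> sphere 0 1" using x by simp
  then obtain a q where q: "a \<in> sphere 0 1" "strict_mono q" "(x \<circ> q) \<longlonglongrightarrow> a"
    using compact_sphere[of "0::'a" 1, unfolded compact_def] by metis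
  define R' x' where "R' = R \<circ> q" and "x' = x \<circ> q"
  have x': "\<And>k. norm (x' k) = 1" "x' \<longlonglongrightarrow> a"
    using x q(3) by (simp_all add: x'_def)
  have R_pos: "R k > 0" for k using R[of k] by linarith
  have "filterlim (\<lambda>k. real (Suc k)) at_top sequentially"
    by (rule filterlim_compose[OF filterlim_real_sequentially filterlim_Suc])
  then have "filterlim R at_top sequentially"
    by (rule filterlim_at_top_mono) (use R in \<open>auto intro!: always_eventually less_imp_le\<close>)
  then have R': "filterlim R' at_top sequentially" "\<And>k. R' k > 0"
    using filterlim_compose[OF _ filterlim_subseq[OF q(2)], of R] R_pos by (simp_all add: R'_def o_def)
  have lim\<phi>: "(\<lambda>k. rescale \<delta>1 (R' k) \<phi> (x' k)) \<longlonglongrightarrow> \<phi>0 a"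
    by (rule leading_term_rescale_tendsto[OF \<phi> R' x'])
  have lim\<psi>: "(\<lambda>k. rescale \<delta>2 (R' k) \<psi> (x' k)) \<longlonglongrightarrow> \<psi>0 a"
    by (rule leading_term_rescale_tendsto[OF \<psi> R' x'])
  have "filterlim (\<lambda>k. R' k powr \<delta>2) at_top sequentially"
    by (rule filterlim_compose[OF filterlim_powr_at_top[OF \<delta>2] R'(1)])
  then obtain r where r: "strict_mono r" and limP:
      "(\<lambda>k. closest_point ((*\<^sub>R) (inverse (R' (r k) powr \<delta>2)) ` S)
          (rescale \<delta>2 (R' (r k)) \<psi> (x' (r k)) - rescale \<delta>1 (R' (r k)) \<phi> (x' (r k))))
        \<longlonglongrightarrow> closest_point (recession_cone S) (\<psi>0 a - \<phi>0 a)"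
    using closest_point_rescaled_set_tendsto[OF S, of "\<lambda>k. R' k powr \<delta>2"
        "\<lambda>k. rescale \<delta>2 (R' k) \<psi> (x' k) - rescale \<delta>1 (R' k) \<phi> (x' k)" "\<psi>0 a - \<phi>0 a"]
      R'(2) tendsto_diff[OF lim\<psi> lim\<phi>]
    by (auto simp: less_imp_neq[symmetric])
  have limN: "(\<lambda>k. ?N (R' (r k)) (x' (r k))) \<longlonglongrightarrow> ?L a"
    unfolding natural_map_def using LIMSEQ_subseq_LIMSEQ[OF lim\<psi> r]
    by (intro tendsto_diff limP) (simp add: o_def)
  have "continuous_on UNIV ?L"
    by (intro continuous_on_natural_map cone)
      (use \<phi> \<psi> in \<open>simp_all add: leading_term_on_iff\<close>)
  then have limN0: "(\<lambda>k. ?L (x' (r k))) \<longlonglongrightarrow> ?L a"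
    using LIMSEQ_subseq_LIMSEQ[OF x'(2) r]
    by (intro continuous_on_tendsto_compose[of UNIV ?L]) (auto simp: o_def)
  \<comment> \<open>Along the subsequence both natural maps tend to \<open>?L a\<close>, so the
    inequality \<open>far\<close> passes to the limit with right-hand side 0.\<close>
  have "norm (?L a) \<le> dist (?L a) (?L a)"
    by (rule tendsto_le[OF sequentially_bot tendsto_dist[OF limN limN0] tendsto_norm[OF limN0]])
      (simp add: R'_def x'_def far)
  then have "a \<in> GVI_SOL UNIV \<phi>0 \<psi>0 (recession_cone S)"
    by (simp add: natural_map_eq_0_iff[OF cone])
  then show False using sol q(1) by auto
qed

text \<open>A solution of large norm, normalised to the unit sphere, would be a zero of the natural
  map rescaled by that norm, at distance exactly the norm of the limiting map from it.\<close>

lemma bounded_GVI_SOL: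
  fixes \<phi> \<psi> \<phi>0 \<psi>0 :: "'a::euclidean_space \<Rightarrow> 'a"
  assumes S: "convex S" "closed S" "S \<noteq> {}"
    and \<phi>: "leading_term_on UNIV \<delta>1 \<phi> \<phi>0" and \<psi>: "leading_term_on UNIV \<delta>2 \<psi> \<psi>0"
    and \<delta>2: "\<delta>2 > 0"
    and sol: "GVI_SOL UNIV \<phi>0 \<psi>0 (recession_cone S) \<subseteq> {0}"
  shows "bounded (GVI_SOL UNIV \<phi> \<psi> S)"
proof -
  have S': "convex ((*\<^sub>R) c ` S)" "closed ((*\<^sub>R) c ` S)" "(*\<^sub>R) c ` S \<noteq> {}" for c
    using S by (simp_all add: convex_scaling closed_scaling)
  obtain B where B: "\<And>R. R \<ge> B \<Longrightarrow> \<forall>x\<in>sphere 0 1.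
      dist (natural_map (rescale \<delta>1 R \<phi>) (rescale \<delta>2 R \<psi>) ((*\<^sub>R) (inverse (R powr \<delta>2)) ` S) x)
         (natural_map \<phi>0 \<psi>0 (recession_cone S) x)
      < norm (natural_map \<phi>0 \<psi>0 (recession_cone S) x)"
    using eventually_rescaled_natural_map_close[OF assms]
    unfolding eventually_at_top_linorder by metis
  have "norm x \<le> max 0 B" if x: "x \<in> GVI_SOL UNIV \<phi> \<psi> S" for x
  proof (rule ccontr)
    assume n: "\<not> norm x \<le> max 0 B"
    define u where "u = x /\<^sub>R norm x"
    have pos: "norm x > 0" using n by linarith
    then have u: "u \<in> sphere 0 1" "norm x *\<^sub>R u = x" by (simp_all add: u_def)
    have "natural_map (rescale \<delta>1 (norm x) \<phi>) (rescale \<delta>2 (norm x) \<psi>)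
        ((*\<^sub>R) (inverse (norm x powr \<delta>2)) ` S) u = 0"
      unfolding natural_map_eq_0_iff[OF S'] GVI_SOL_rescale[OF pos] u(2) by (rule x)
    with B[of "norm x"] n u(1) show False by (force simp: dist_norm)
  qed
  then show ?thesis unfolding bounded_iff by blast
qed

section \<open>Existence by comparing homotopy classes\<close>

lemma homotopic_in_complement_zero_if_close:
  fixes N N0 :: "'a::euclidean_space \<Rightarrow> 'a"
  assumes "continuous_on A N" "continuous_on A N0"
    and close: "\<And>x. x \<in> A \<Longrightarrow> dist (N x) (N0 x) < norm (N0 x)"
  shows "homotopic_with_canon (\<lambda>_. True) A (- {0}) N N0"
proof (rule homotopic_with_linear[OF assms(1,2)])
  fix x assume "x \<in> A"
  \<comment> \<open>The open ball about \<open>N0 x\<close> whose radius is the norm of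
    \<open>N0 x\<close> is convex and misses 0.\<close>
  then have "closed_segment (N x) (N0 x) \<subseteq> ball (N0 x) (norm (N0 x))"
    using close[of x] by (intro closed_segment_subset) (auto simp: dist_commute intro: le_less_trans[OF zero_le_dist])
  then show "closed_segment (N x) (N0 x) \<subseteq> - {0}" by (auto simp: dist_norm)
qed

text \<open>The hypothesis puts \<open>a\<close> in the polar cone, which projects to the
  apex.\<close>

lemma closest_point_cone_eq_0:
  fixes S :: "'a::euclidean_space set"
  assumes S: "convex_cone S" "closed S" and a: "- a \<in> dual_cone S"
  shows "closest_point S a = 0"
  using S a convex_cone_contains_0[OF S(1)]
  by (subst closest_point_eq_iff) (auto simp: convex_cone_def dual_cone_def)

lemma dual_cone_scaleR: "u \<in> dual_cone S \<Longrightarrow> 0 \<le> c \<Longrightarrow> c *\<^sub>R u \<in> dual_cone S"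
  by (simp add: dual_cone_def)

text \<open>The primed mappings form the reference problem. It is posed over the recession cone,
  which is its own recession cone, so both problems have the same limiting natural map
  \<open>N0\<close>.\<close>

proposition GVI_SOL_nonempty:
  fixes \<phi> \<psi> \<phi>0 \<psi>0 \<phi>' \<psi>' :: "'a::euclidean_space \<Rightarrow> 'a"
  assumes S: "convex S" "closed S" "S \<noteq> {}"
    and \<delta>2: "\<delta>2 > 0"
    and \<phi>: "leading_term_on UNIV \<delta>1 \<phi> \<phi>0" and \<psi>: "leading_term_on UNIV \<delta>2 \<psi> \<psi>0"
    and sol: "GVI_SOL UNIV \<phi>0 \<psi>0 (recession_cone S) \<subseteq> {0}"
    and \<phi>': "leading_term_on UNIV \<delta>1 \<phi>' \<phi>0" and \<psi>': "leading_term_on UNIV \<delta>2 \<psi>' \<psi>0"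
    and sol': "GVI_SOL UNIV \<phi>' \<psi>' (recession_cone S) \<subseteq> {0}"
    and inj: "inj \<psi>'" and \<psi>'0: "\<psi>' 0 = 0"
    and \<phi>'0: "\<phi>' 0 \<in> interior (dual_cone (recession_cone S))"
  shows "GVI_SOL UNIV \<phi> \<psi> S \<noteq> {}"
proof
  assume empty: "GVI_SOL UNIV \<phi> \<psi> S = {}"
  let ?K = "recession_cone S"
  have coneK: "convex_cone ?K" and K: "convex ?K" "closed ?K" "?K \<noteq> {}"
    using closed_recession_cone[OF S(2,1,3)] convex_cone_recession_cone[OF S(2,1,3)]
    by (auto simp: convex_cone_def)
  have KK: "recession_cone ?K = ?K"
    by (rule recession_cone_closed_convex_cone[OF coneK K(2)])
  define N where "N R = natural_map (rescale \<delta>1 R \<phi>) (rescale \<delta>2 R \<psi>)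
      ((*\<^sub>R) (inverse (R powr \<delta>2)) ` S)" for R
  define N' where "N' R = natural_map (rescale \<delta>1 R \<phi>') (rescale \<delta>2 R \<psi>')
      ((*\<^sub>R) (inverse (R powr \<delta>2)) ` ?K)" for R
  define N0 where "N0 = natural_map \<phi>0 \<psi>0 ?K"
  have "\<forall>\<^sub>F R in at_top. \<forall>x\<in>sphere 0 1. dist (N R x) (N0 x) < norm (N0 x)"
    using eventually_rescaled_natural_map_close[OF S \<phi> \<psi> \<delta>2 sol] unfolding N_def N0_def .
  moreover have "\<forall>\<^sub>F R in at_top. \<forall>x\<in>sphere 0 1. dist (N' R x) (N0 x) < norm (N0 x)"
    using eventually_rescaled_natural_map_close[OF K \<phi>' \<psi>' \<delta>2, unfolded KK, OF sol]
    unfolding N'_def N0_def .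
  ultimately obtain B B' where B: "\<And>R x. B \<le> R \<Longrightarrow> x \<in> sphere 0 1 \<Longrightarrow> dist (N R x) (N0 x) < norm (N0 x)"
      and B': "\<And>R x. B' \<le> R \<Longrightarrow> x \<in> sphere 0 1 \<Longrightarrow> dist (N' R x) (N0 x) < norm (N0 x)"
    unfolding eventually_at_top_linorder by blast
  define R where "R = max 1 (max B B')"
  have R: "R > 0" by (simp add: R_def)
  have close: "dist (N R x) (N0 x) < norm (N0 x)" if "x \<in> sphere 0 1" for x
    using B[of R x] that by (simp add: R_def)
  have close': "dist (N' R x) (N0 x) < norm (N0 x)" if "x \<in> sphere 0 1" for x
    using B'[of R x] that by (simp add: R_def)
  have image: "convex ((*\<^sub>R) c ` A)" "closed ((*\<^sub>R) c ` A)" "(*\<^sub>R) c ` A \<noteq> {}"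
    if "convex A" "closed A" "A \<noteq> {}" for c and A :: "'a set"
    using that by (simp_all add: convex_scaling closed_scaling)
  have cont: "continuous_on UNIV \<phi>" "continuous_on UNIV \<psi>" "continuous_on UNIV \<phi>0"
      "continuous_on UNIV \<psi>0" "continuous_on UNIV \<phi>'" "continuous_on UNIV \<psi>'"
    using \<phi> \<psi> \<phi>' \<psi>' by (simp_all add: leading_term_on_iff)
  have contN: "continuous_on A (N R)" for A
    unfolding N_def by (intro continuous_on_natural_map image S continuous_on_rescale cont)
  have contN': "continuous_on A (N' R)" for A
    unfolding N'_def by (intro continuous_on_natural_map image K continuous_on_rescale cont)
  have contN0: "continuous_on A N0" for A
    unfolding N0_def
    by (intro continuous_on_natural_map K cont[THEN continuous_on_subset] subset_UNIV)
  have hom: "homotopic_with_canon (\<lambda>_. True) (sphere 0 1) (- {0}) (N R) N0"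
    by (intro homotopic_in_complement_zero_if_close contN contN0 close)
  have hom': "homotopic_with_canon (\<lambda>_. True) (sphere 0 1) (- {0}) (N' R) N0"
    by (intro homotopic_in_complement_zero_if_close contN' contN0 close')
  \<comment> \<open>Unsolvability excludes zeros on the whole ball, so \<open>N R\<close> is itself
    a zero-free extension from the sphere.\<close>
  have "N R x \<noteq> 0" for x
    unfolding N_def natural_map_eq_0_iff[OF image[OF S]] GVI_SOL_rescale[OF R] empty by simp
  then have "\<exists>h. continuous_on (cball 0 1) h \<and> h ` cball 0 1 \<subseteq> - {0} \<and> (\<forall>x\<in>sphere 0 1. h x = N R x)"
    using contN by (intro exI[of _ "N R"]) auto
  then obtain c where "homotopic_with_canon (\<lambda>_. True) (sphere 0 1) (- {0}) (N R) (\<lambda>_. c)"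
    unfolding nullhomotopic_from_sphere_extension[symmetric] ..
  then have null: "homotopic_with_canon (\<lambda>_. True) (sphere 0 1) (- {0}) (N' R) (\<lambda>_. c)"
    using hom' hom homotopic_with_trans homotopic_with_symD by metis
  have N'_nz: "N' R x \<noteq> 0" if "x \<noteq> 0" for x
    unfolding N'_def natural_map_eq_0_iff[OF image[OF K]] GVI_SOL_rescale[OF R]
    using sol' that R by auto
  have image_K: "(*\<^sub>R) (inverse (R powr \<delta>2)) ` ?K = ?K"
  proof
    show "(*\<^sub>R) (inverse (R powr \<delta>2)) ` ?K \<subseteq> ?K"
      by (auto intro: convex_cone_scaleR[OF coneK])
    show "?K \<subseteq> (*\<^sub>R) (inverse (R powr \<delta>2)) ` ?K"
    proof
      fix u assume "u \<in> ?K"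
      then have "(R powr \<delta>2) *\<^sub>R u \<in> ?K" by (intro convex_cone_scaleR[OF coneK]) auto
      then show "u \<in> (*\<^sub>R) (inverse (R powr \<delta>2)) ` ?K"
        using R by (intro image_eqI[of _ _ "(R powr \<delta>2) *\<^sub>R u"]) auto
    qed
  qed
  \<comment> \<open>\<open>w\<close> is, up to a positive factor, the negative of the projected
    vector. The factor is chosen so that \<open>w 0\<close> equals \<open>\<phi>' 0\<close>; near 0
    continuity then keeps \<open>w\<close> in the dual cone, and the projection vanishes.\<close>
  define w where "w x = (R powr \<delta>1) *\<^sub>R (rescale \<delta>1 R \<phi>' x - rescale \<delta>2 R \<psi>' x)" for x
  have "continuous_on UNIV w"
    unfolding w_def by (intro continuous_intros continuous_on_rescale cont)
  moreover have "w 0 \<in> interior (dual_cone ?K)"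
    using R \<phi>'0 by (simp add: w_def rescale_def \<psi>'0)
  ultimately have "open (w -` interior (dual_cone ?K))" "0 \<in> w -` interior (dual_cone ?K)"
    by (simp_all add: open_vimage)
  then obtain \<epsilon>0 where \<epsilon>0: "\<epsilon>0 > 0" "cball 0 \<epsilon>0 \<subseteq> w -` interior (dual_cone ?K)"
    by (meson open_contains_cball)
  define \<epsilon> where "\<epsilon> = min 1 \<epsilon>0"
  have N'_eq: "N' R x = rescale \<delta>2 R \<psi>' x" if "x \<in> cball 0 \<epsilon>" for x
  proof -
    have "w x \<in> dual_cone ?K"
      using \<epsilon>0(2) that interior_subset by (force simp: \<epsilon>_def)
    then have "inverse (R powr \<delta>1) *\<^sub>R w x \<in> dual_cone ?K"
      by (rule dual_cone_scaleR) simp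
    then have "- (rescale \<delta>2 R \<psi>' x - rescale \<delta>1 R \<phi>' x) \<in> dual_cone ?K"
      using R by (simp add: w_def)
    from closest_point_cone_eq_0[OF coneK K(2) this] show ?thesis
      by (simp add: N'_def natural_map_def image_K)
  qed
  have "inj_on (N' R) (cball 0 \<epsilon>)"
  proof (rule inj_onI)
    fix x y assume "x \<in> cball 0 \<epsilon>" "y \<in> cball 0 \<epsilon>" "N' R x = N' R y"
    then have "\<psi>' (R *\<^sub>R x) = \<psi>' (R *\<^sub>R y)"
      using R by (simp only: N'_eq) (simp add: rescale_def)
    then show "x = y" using inj R by (simp add: inj_eq)
  qed
  moreover have "0 < \<epsilon>" "\<epsilon> \<le> 1" using \<epsilon>0(1) by (auto simp: \<epsilon>_def)
  moreover have "N' R 0 = 0" using \<open>0 < \<epsilon>\<close> by (simp add: N'_eq rescale_def \<psi>'0)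
  ultimately show False
    using not_nullhomotopic_if_isolated_injective_zero[OF contN' N'_nz] null by blast
qed

lemma compact_GVI_SOL:
  fixes \<phi> \<psi> \<phi>0 \<psi>0 :: "'a::euclidean_space \<Rightarrow> 'a"
  assumes S: "convex S" "closed S" "S \<noteq> {}"
    and \<phi>: "leading_term_on UNIV \<delta>1 \<phi> \<phi>0" and \<psi>: "leading_term_on UNIV \<delta>2 \<psi> \<psi>0"
    and \<delta>2: "\<delta>2 > 0"
    and sol: "GVI_SOL UNIV \<phi>0 \<psi>0 (recession_cone S) \<subseteq> {0}"
  shows "compact (GVI_SOL UNIV \<phi> \<psi> S)"
proof -
  have "GVI_SOL UNIV \<phi> \<psi> S = natural_map \<phi> \<psi> S -` {0}"
    using natural_map_eq_0_iff[OF S] by auto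
  moreover have "closed (natural_map \<phi> \<psi> S -` {0})"
    using continuous_on_natural_map[OF S, of UNIV \<phi> \<psi>] \<phi> \<psi>
    by (intro closed_vimage) (auto simp: leading_term_on_iff)
  ultimately show ?thesis
    using bounded_GVI_SOL[OF assms] by (simp add: compact_eq_bounded_closed)
qed

section \<open>Restricted domains, complementarity and uniqueness\<close>

lemma GVI_SOL_extend:
  assumes "\<And>x. x \<in> C \<Longrightarrow> \<phi>' x = \<phi> x" and "\<And>x. \<psi> x \<in> S \<Longrightarrow> x \<in> C"
  shows "GVI_SOL C \<phi> \<psi> S = GVI_SOL UNIV \<phi>' \<psi> S"
  using assms by (auto simp: GVI_SOL_def)

text \<open>Testing the inequality at \<open>y + \<psi> x\<close> gives membership in the dual cone;
  testing at 0 gives the other sign needed for orthogonality.\<close>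

lemma GCP_SOL_eq_GVI_SOL:
  assumes S: "convex_cone S"
  shows "GCP_SOL D \<phi> \<psi> S = GVI_SOL D \<phi> \<psi> S"
proof (intro set_eqI iffI)
  fix x assume "x \<in> GCP_SOL D \<phi> \<psi> S"
  then show "x \<in> GVI_SOL D \<phi> \<psi> S"
    by (auto simp: GCP_SOL_def GVI_SOL_def dual_cone_def inner_diff_right)
next
  fix x assume "x \<in> GVI_SOL D \<phi> \<psi> S"
  then have x: "x \<in> D" "\<psi> x \<in> S" and vi: "\<And>y. y \<in> S \<Longrightarrow> 0 \<le> \<phi> x \<bullet> (y - \<psi> x)"
    by (auto simp: GVI_SOL_def)
  have "0 \<le> \<phi> x \<bullet> y" if "y \<in> S" for y
    using vi[OF convex_cone_add[OF S that x(2)]] by simp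
  moreover have "\<phi> x \<bullet> \<psi> x \<le> 0"
    using vi[OF convex_cone_contains_0[OF S]] by (simp add: inner_diff_right)
  ultimately show "x \<in> GCP_SOL D \<phi> \<psi> S"
    using x by (simp add: GCP_SOL_def dual_cone_def antisym)
qed

text \<open>Each inequality is tested at the value of the other solution; their sum contradicts
  strict monotonicity.\<close>

lemma GVI_SOL_unique:
  assumes mono: "strictly_monotone_wrt D \<phi> \<psi> S"
    and x: "x \<in> GVI_SOL D \<phi> \<psi> S" and y: "y \<in> GVI_SOL D \<phi> \<psi> S"
  shows "x = y"
proof (rule ccontr)
  assume "x \<noteq> y"
  then have "0 < (\<phi> x - \<phi> y) \<bullet> (\<psi> x - \<psi> y)"
    using mono x y by (auto simp: strictly_monotone_wrt_def GVI_SOL_def)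
  moreover have "0 \<le> \<phi> x \<bullet> (\<psi> y - \<psi> x)" "0 \<le> \<phi> y \<bullet> (\<psi> x - \<psi> y)"
    using x y by (auto simp: GVI_SOL_def)
  ultimately show False by (simp add: inner_diff_left inner_diff_right)
qed

text \<open>An interior \<open>d\<close> stays in the dual cone after subtracting a small multiple
  of \<open>v\<close>; pairing the difference with \<open>v\<close> makes
  \<open>d \<bullet> v\<close> positive unless \<open>v = 0\<close>.\<close>

lemma interior_dual_cone_inner_nonpos:
  fixes d :: "'a::euclidean_space"
  assumes d: "d \<in> interior (dual_cone S)" and v: "v \<in> S" "d \<bullet> v \<le> 0"
  shows "v = 0"
proof (rule ccontr)
  assume "v \<noteq> 0"
  obtain e where e: "e > 0" "cball d e \<subseteq> dual_cone S"
    using d by (meson interior_subset open_contains_cball open_interior subset_trans)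
  define t where "t = e / norm v"
  have t: "t > 0" using e(1) \<open>v \<noteq> 0\<close> by (simp add: t_def)
  have "d - t *\<^sub>R v \<in> cball d e"
    using \<open>v \<noteq> 0\<close> e(1) by (simp add: dist_norm t_def)
  then have "d - t *\<^sub>R v \<in> dual_cone S" using e(2) by blast
  then have "0 \<le> (d - t *\<^sub>R v) \<bullet> v" using v(1) by (simp add: dual_cone_def)
  moreover have "0 < t * (v \<bullet> v)" using t \<open>v \<noteq> 0\<close> by simp
  ultimately show False using v(2) by (simp add: inner_diff_left)
qed

text \<open>Scaling \<open>x\<close> far out puts the remainder into \<open>C\<close>, hence also
  \<psi> of the scaled point as a sum of two elements of \<open>C\<close>. The preimage condition
  applies there, and scaling back returns to \<open>x\<close>.\<close>

lemma leading_term_preimage_cone: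
  fixes C :: "'a::euclidean_space set"
  assumes C: "convex_cone C"
    and lt: "leading_term_on UNIV \<delta> \<psi> h"
    and preimage: "\<psi> -` C \<subseteq> C" and rest: "\<forall>\<^sub>F x in at_infinity. \<psi> x - h x \<in> C"
    and hx: "h x \<in> C"
  shows "x \<in> C"
proof (cases "x = 0")
  case True
  then show ?thesis using convex_cone_contains_0[OF C] by simp
next
  case False
  obtain B where B: "\<And>y. B \<le> norm y \<Longrightarrow> \<psi> y - h y \<in> C"
    using rest unfolding eventually_at_infinity by blast
  define l where "l = max 1 (B / norm x)"
  have l: "l > 0" by (simp add: l_def)
  have "B / norm x \<le> l" by (simp add: l_def)
  then have "B \<le> norm (l *\<^sub>R x)" using False l by (simp add: field_simps)
  then have "\<psi> (l *\<^sub>R x) - h (l *\<^sub>R x) \<in> C" by (rule B)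
  moreover have "h (l *\<^sub>R x) \<in> C"
    using lt l hx convex_cone_scaleR[OF C _ hx, of "l powr \<delta>"] by (simp add: leading_term_on_iff)
  ultimately have "\<psi> (l *\<^sub>R x) \<in> C"
    using convex_cone_add[OF C, of "\<psi> (l *\<^sub>R x) - h (l *\<^sub>R x)" "h (l *\<^sub>R x)"] by simp
  then have "l *\<^sub>R x \<in> C" using preimage by auto
  from convex_cone_scaleR[OF C _ this, of "inverse l"] show ?thesis using l by simp
qed

theorem mainTheorem10:
  fixes C K :: "'a::euclidean_space set"
    and f finf fbar g ginf gbar F Finf :: "'a \<Rightarrow> 'a"
    and p q :: 'a
    and \<delta>1 \<delta>2 :: real
  assumes C: "convex_cone C" "closed C"
    and K: "K \<noteq> {}" "closed K" "convex K" "K \<subseteq> C"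
    and K_pointed: "pointed_cone (recession_cone K)"
    and f_wh: "weakly_homogeneous_on C \<delta>1 f" "leading_term_on C \<delta>1 f finf"
    and g_wh: "weakly_homogeneous_on UNIV \<delta>2 g" "leading_term_on UNIV \<delta>2 g ginf"
    and f_split: "\<And>x. x \<in> C \<Longrightarrow> f x = finf x + fbar x + p"
    and g_split: "\<And>x. g x = ginf x + gbar x + q"
    and F_ext: "continuous_on UNIV F" "\<And>x. x \<in> C \<Longrightarrow> F x = finf x + fbar x - fbar 0"
    and Finf_ext: "continuous_on UNIV Finf" "\<And>x. x \<in> C \<Longrightarrow> Finf x = finf x"
    and g_preimage: "g -` C \<subseteq> C"
    and g_rest: "\<forall>\<^sub>F x in at_infinity. gbar x + q \<in> C"
    and main: "\<exists>d \<in> interior (dual_cone (recession_cone K)).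
        (GVI_SOL C finf ginf (recession_cone K) = {0} \<and>
         GVI_SOL C (\<lambda>x. finf x + fbar x - fbar 0 + d) g (recession_cone K) = {0} \<and>
         inj g \<and>
         (\<exists>xstar. g xstar = 0 \<and>
            (\<forall>\<^sub>F x in nhds xstar.
               ereal (dist (F x) (g x))
                 < point_set_dist d (frontier (dual_cone (recession_cone K)))))) \<or>
        (GVI_SOL C finf ginf (recession_cone K) = {0} \<and>
         GVI_SOL C (\<lambda>x. finf x + d) ginf (recession_cone K) = {0} \<and>
         inj ginf)"
  shows "GVI_SOL C f g K \<noteq> {} \<and> compact (GVI_SOL C f g K) \<and>
         GCP_SOL C f g (recession_cone K) \<noteq> {} \<and> compact (GCP_SOL C f g (recession_cone K)) \<and>
         (strictly_monotone_wrt C f g K \<longrightarrow> (\<exists>!x. x \<in> GVI_SOL C f g K)) \<and>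
         (strictly_monotone_wrt C f g (recession_cone K) \<longrightarrow>
            (\<exists>!x. x \<in> GCP_SOL C f g (recession_cone K)))"
proof -
  let ?P = "closest_point C" and ?Ki = "recession_cone K"
  have C': "C \<noteq> {}" "0 \<in> C" using C(1) by (simp_all add: convex_cone_nonempty convex_cone_contains_0)
  have P: "?P x = x" if "x \<in> C" for x using that by (rule closest_point_self)
  have \<delta>: "\<delta>1 > 0" "\<delta>2 > 0" using f_wh(1) g_wh(1) by (auto simp: weakly_homogeneous_on_def)
  have lf: "leading_term_on UNIV \<delta>1 (f \<circ> ?P) (finf \<circ> ?P)"
    by (rule leading_term_on_compose_closest_point[OF C \<delta>(1) f_wh(2)])
  have finf0: "finf 0 = 0" by (rule leading_term_on_zero[OF f_wh(2) \<delta>(1) C'(2)])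
  have ginf0: "ginf 0 = 0" by (rule leading_term_on_zero[OF g_wh(2) \<delta>(2)]) simp
  have coneKi: "convex_cone ?Ki" and Ki: "convex ?Ki" "closed ?Ki" "?Ki \<noteq> {}"
    using closed_recession_cone[OF K(2,3,1)] convex_cone_recession_cone[OF K(2,3,1)]
    by (auto simp: convex_cone_def)
  have Ki_C: "?Ki \<subseteq> C" by (rule recession_cone_subset[OF C K(4)])
  have g_in: "x \<in> C" if "g x \<in> C" for x using g_preimage that by auto
  have "\<forall>\<^sub>F x in at_infinity. g x - ginf x \<in> C"
    using g_rest by eventually_elim (simp add: g_split)
  then have ginf_in: "x \<in> C" if "ginf x \<in> C" for x
    using leading_term_preimage_cone[OF C(1) g_wh(2) g_preimage _ that] by blast
  obtain d where d: "d \<in> interior (dual_cone ?Ki)"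
      and sol: "GVI_SOL C finf ginf ?Ki = {0}"
      and ab: "(GVI_SOL C (\<lambda>x. finf x + fbar x - fbar 0 + d) g ?Ki = {0} \<and> inj g) \<or>
        (GVI_SOL C (\<lambda>x. finf x + d) ginf ?Ki = {0} \<and> inj ginf)"
    using main by blast
  have sol': "GVI_SOL UNIV (finf \<circ> ?P) ginf ?Ki \<subseteq> {0}"
    using GVI_SOL_extend[of C "finf \<circ> ?P" finf ginf ?Ki] P ginf_in Ki_C sol by auto
  \<comment> \<open>Both alternatives are reduced to one kind of reference problem, with
    \<open>\<psi>'\<close> being \<open>g\<close> in the first and \<open>ginf\<close> in the
    second.\<close>
  obtain \<phi>' \<psi>' where \<phi>': "leading_term_on UNIV \<delta>1 \<phi>' (finf \<circ> ?P)" "\<phi>' 0 = d"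
      and \<psi>': "leading_term_on UNIV \<delta>2 \<psi>' ginf" "inj \<psi>'" "\<psi>' 0 = 0"
      and ref: "GVI_SOL UNIV \<phi>' \<psi>' ?Ki \<subseteq> {0}"
    using ab
  proof (elim disjE conjE)
    assume a: "GVI_SOL C (\<lambda>x. finf x + fbar x - fbar 0 + d) g ?Ki = {0}" "inj g"
    \<comment> \<open>On \<open>C\<close> the constant replaces \<open>p\<close> by
      \<open>d - fbar 0\<close>, so the value at 0 is \<open>d\<close>.\<close>
    let ?\<phi> = "\<lambda>x. (f \<circ> ?P) x + (d - p - fbar 0)"
    \<comment> \<open>Since 0 solves the reference problem, \<open>g 0\<close> lies in the recession
      cone and testing at 0 gives \<open>d \<bullet> g 0 \<le> 0\<close>; interiority of
      \<open>d\<close> then forces \<open>g 0 = 0\<close>.\<close>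
    have "0 \<in> GVI_SOL C (\<lambda>x. finf x + fbar x - fbar 0 + d) g ?Ki" by (simp add: a(1))
    then have "g 0 \<in> ?Ki" "0 \<le> d \<bullet> (0 - g 0)"
      using convex_cone_contains_0[OF coneKi] by (auto simp: GVI_SOL_def finf0)
    then have g0: "g 0 = 0" by (intro interior_dual_cone_inner_nonpos[OF d]) auto
    have "GVI_SOL C (\<lambda>x. finf x + fbar x - fbar 0 + d) g ?Ki = GVI_SOL UNIV ?\<phi> g ?Ki"
    proof (rule GVI_SOL_extend)
      show "?\<phi> x = finf x + fbar x - fbar 0 + d" if "x \<in> C" for x
        using that by (simp add: P f_split)
    qed (use g_in Ki_C in blast)
    moreover have "?\<phi> 0 = d" using f_split[OF C'(2)] by (simp add: P C'(2) finf0)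
    ultimately show thesis
      using that[of ?\<phi> g] leading_term_on_add_const[OF lf \<delta>(1)] a g_wh(2) g0 by simp
  next
    assume b: "GVI_SOL C (\<lambda>x. finf x + d) ginf ?Ki = {0}" "inj ginf"
    let ?\<phi> = "\<lambda>x. (finf \<circ> ?P) x + d"
    have "GVI_SOL C (\<lambda>x. finf x + d) ginf ?Ki = GVI_SOL UNIV ?\<phi> ginf ?Ki"
    proof (rule GVI_SOL_extend)
      show "?\<phi> x = finf x + d" if "x \<in> C" for x using that by (simp add: P)
    qed (use ginf_in Ki_C in blast)
    moreover have "?\<phi> 0 = d" by (simp add: P C'(2) finf0)
    ultimately show thesis
      using that[of ?\<phi> ginf] leading_term_on_add_const[OF leading_term_on_self[OF lf] \<delta>(1)] b
        leading_term_on_self[OF g_wh(2)] ginf0 by simp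
  qed
  \<comment> \<open>A general \<open>S\<close> with the given recession cone covers both
    \<open>K\<close> and the cone itself.\<close>
  have solvable: "GVI_SOL C f g S \<noteq> {}" "compact (GVI_SOL C f g S)"
    if S: "convex S" "closed S" "S \<noteq> {}" "S \<subseteq> C" "recession_cone S = ?Ki" for S
  proof -
    have "GVI_SOL C f g S = GVI_SOL UNIV (f \<circ> ?P) g S"
    proof (rule GVI_SOL_extend)
      show "(f \<circ> ?P) x = f x" if "x \<in> C" for x using that by (simp add: P)
    qed (use g_in S(4) in blast)
    then show "GVI_SOL C f g S \<noteq> {}" "compact (GVI_SOL C f g S)"
      using GVI_SOL_nonempty[OF S(1-3) \<delta>(2) lf g_wh(2) _ \<phi>'(1) \<psi>'(1) _ \<psi>'(2,3)]
        compact_GVI_SOL[OF S(1-3) lf g_wh(2) \<delta>(2)] sol' ref d \<phi>'(2)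
      by (simp_all add: S(5))
  qed
  note gvi = solvable[OF K(3,2,1,4) refl]
  note gcp = solvable[OF Ki Ki_C recession_cone_closed_convex_cone[OF coneKi Ki(2)],
      folded GCP_SOL_eq_GVI_SOL[OF coneKi]]
  show ?thesis
    using gvi gcp GVI_SOL_unique[of C f g K] GVI_SOL_unique[of C f g ?Ki]
    unfolding GCP_SOL_eq_GVI_SOL[OF coneKi] by blast
qed

end
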